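(* Let $n, k$ be integers with $1 \le n \le k$. Then $\operatorname{St}_{\operatorname{orth}}(n,\mathbb{R}^k)$ is connected if and only if $k \geq n+1$. For $k=n$, $\operatorname{St}_{\operatorname{orth}}(n,\mathbb{R}^n)$ consists of exactly two connected components, distinguished by the sign of the determinant of the $n\times n$ matrix whose columns are the frame vectors $v_1,\ldots,v_n$.
   Context: $\operatorname{St}_{\operatorname{orth}}(n,\mathbb{R}^k) = \{(v_1,\ldots,v_n)\in (\mathbb{R}^k)^n : \langle v_i,v_j\rangle = \delta_{ij} \text{ for all } i,j\}$, where $\langle\cdot,\cdot\rangle$ is the standard inner product, with the subspace topology from $(\mathbb{R}^k)^n$. *)

theory Defs
  imports "HOL-Analysis.Analysis"
begin

text \<open>
  With n = CARD('n) and k = CARD('k), an n-tuple of vectors of R^k is an element of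
  \<^typ>\<open>real^'k^'n\<close>, whose topology is the product topology of (R^k)^n. A frame is
  indexed by its vectors, so as a matrix it has the frame vectors as its rows.
\<close>

definition St_orth :: "(real^'k^'n) set" where
  "St_orth = {v. \<forall>i j. v $ i \<bullet> v $ j = (if i = j then 1 else 0)}"

definition frame_matrix :: "real^'k^'n \<Rightarrow> real^'n^'k" where
  "frame_matrix v = (\<chi> i j. v $ j $ i)"

lemma column_frame_matrix: "column j (frame_matrix v) = v $ j"
  by (simp add: column_def frame_matrix_def vec_eq_iff)

end

theory Submission imports Defs begin

text \<open>
  Hyperplane reflections act on frames. Any frame is carried to any other one by matching their
  vectors one at a time, each by a single reflection that fixes the vectors already matched.
  Since the nonzero normals form a connected set (or, in dimension one, all give the same
  reflection), the connected component of a reflected frame does not depend on the normal.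
  If \<open>n < k\<close>, some normal is orthogonal to the whole frame, so every reflected frame lies in the
  component of the original one and there is only one component. If \<open>n = k\<close>, there are at most
  two components, and the determinant, which takes only the values 1 and -1, separates them.
\<close>

section \<open>Reflections and their action on frames\<close>

text \<open>For \<open>c = 0\<close> this is the identity, so it is a linear isometric involution
  for every \<open>c\<close>.\<close>

definition reflect :: "'a::euclidean_space \<Rightarrow> 'a \<Rightarrow> 'a" where
  "reflect c x = x - (2 * (c \<bullet> x) / (c \<bullet> c)) *\<^sub>R c"

definition reflect_frame :: "real^'k \<Rightarrow> real^'k^'n \<Rightarrow> real^'k^'n" where
  "reflect_frame c v = (\<chi> i. reflect c (v $ i))"

lemma reflect_orthogonal: "c \<bullet> x = 0 \<Longrightarrow> reflect c x = x"
  by (simp add: reflect_def)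

lemma inner_reflect_reflect [simp]: "reflect c x \<bullet> reflect c y = x \<bullet> y"
proof (cases "c = 0")
  case False
  then show ?thesis
    by (simp add: reflect_def inner_diff_left inner_diff_right inner_commute)
qed (simp add: reflect_def)

lemma reflect_reflect [simp]: "reflect c (reflect c x) = x"
proof (cases "c = 0")
  case False
  then show ?thesis
    by (simp add: reflect_def inner_diff_right algebra_simps)
qed (simp add: reflect_def)

text \<open>For vectors of equal length, the hyperplane normal to \<open>x - y\<close> bisects the
  segment from \<open>x\<close> to \<open>y\<close>. The computation shows that the coefficient of
  \<open>c\<close> is exactly 1.\<close>

lemma reflect_diff:
  assumes "x \<bullet> x = y \<bullet> y" and "x \<noteq> y"
  shows "reflect (x - y) x = y"
proof -
  have "2 * ((x - y) \<bullet> x) = (x - y) \<bullet> (x - y)"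
    using assms(1) by (simp add: inner_diff_left inner_diff_right inner_commute)
  moreover have "(x - y) \<bullet> (x - y) \<noteq> 0"
    using assms(2) by (simp only: inner_eq_zero_iff right_minus_eq not_False_eq_True)
  ultimately have "2 * ((x - y) \<bullet> x) / ((x - y) \<bullet> (x - y)) = 1"
    by (metis divide_self)
  then show ?thesis
    unfolding reflect_def by (simp only: scaleR_one diff_diff_eq2 add_diff_cancel_left')
qed

lemma reflect_scaleR: "r \<noteq> 0 \<Longrightarrow> reflect (r *\<^sub>R c) = reflect c"
  by (auto simp: reflect_def fun_eq_iff)

lemma reflect_frame_reflect_frame [simp]: "reflect_frame c (reflect_frame c v) = v"
  by (simp add: reflect_frame_def)

lemma reflect_frame_in_St_orth: "v \<in> St_orth \<Longrightarrow> reflect_frame c v \<in> St_orth"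
  by (simp add: St_orth_def reflect_frame_def)

lemma continuous_on_reflect_frame: "continuous_on S (reflect_frame c)"
  unfolding reflect_frame_def reflect_def
  by (cases "c = 0") (auto intro!: continuous_intros)

lemma continuous_on_reflect_frame_normal: "continuous_on (- {0}) (\<lambda>c. reflect_frame c v)"
  unfolding reflect_frame_def reflect_def by (auto intro!: continuous_intros)

section \<open>Transitivity of reflections and connected components\<close>

text \<open>Reflections act transitively on frames, cast as an induction principle. The inner
  induction is over the set \<open>S\<close> of indices where the moving frame \<open>x\<close>
  already agrees with \<open>w\<close>.\<close>

lemma St_orth_reflect_induct:
  fixes v w :: "real^'k^'n"
  assumes v: "v \<in> St_orth" "P v" and w: "w \<in> St_orth"
    and step: "\<And>c x. c \<noteq> 0 \<Longrightarrow> x \<in> St_orth \<Longrightarrow> P x \<Longrightarrow> P (reflect_frame c x)"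
  shows "P w"
proof -
  have "\<exists>x. x \<in> St_orth \<and> P x \<and> (\<forall>i\<in>S. x $ i = w $ i)" if "finite S" for S
    using that
  proof induction
    case empty
    then show ?case using v by auto
  next
    case (insert i S)
    then obtain x where x: "x \<in> St_orth" "P x" "\<And>j. j \<in> S \<Longrightarrow> x $ j = w $ j"
      by blast
    show ?case
    proof (cases "x $ i = w $ i")
      case True
      then show ?thesis using x by auto
    next
      case False
      let ?c = "x $ i - w $ i"
      have "reflect ?c (x $ i) = w $ i"
        using False x(1) w by (intro reflect_diff) (auto simp: St_orth_def)
      \<comment> \<open>A matched vector belongs to both frames, so it is orthogonal to
        \<open>x $ i\<close> and to \<open>w $ i\<close>, hence to the normal
        \<open>?c\<close>.\<close>
      moreover have "reflect ?c (x $ j) = w $ j" if "j \<in> S" for j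
      proof -
        have "j \<noteq> i" using that insert by auto
        then have "x $ i \<bullet> x $ j = 0" "w $ i \<bullet> w $ j = 0"
          using x(1) w by (auto simp: St_orth_def)
        then have "?c \<bullet> x $ j = 0"
          using x(3)[OF that] by (simp add: inner_diff_left)
        then show ?thesis
          using x(3)[OF that] by (simp add: reflect_orthogonal)
      qed
      ultimately show ?thesis
        using x False step[of ?c x] reflect_frame_in_St_orth[of x ?c]
        by (intro exI[of _ "reflect_frame ?c x"]) (auto simp: reflect_frame_def)
    qed
  qed
  from this[of UNIV] obtain x where "P x" "\<forall>i. x $ i = w $ i"
    by auto
  then show ?thesis
    by (simp flip: vec_eq_iff)
qed

text \<open>In dimension at least 2 the punctured space of normals is connected, and so is its
  continuous image. On a line it is disconnected, but there any two normals are proportional and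
  give the same reflection.\<close>

lemma connected_component_reflect_frame_normal:
  fixes v :: "real^'k^'n"
  assumes v: "v \<in> St_orth" and "a \<noteq> 0" "c \<noteq> 0"
  shows "connected_component St_orth (reflect_frame a v) (reflect_frame c v)"
proof (cases "2 \<le> DIM(real^'k)")
  case True
  let ?T = "(\<lambda>c. reflect_frame c v) ` (- {0})"
  have "connected ?T"
    by (intro connected_continuous_image continuous_on_reflect_frame_normal
        connected_punctured_universe True)
  moreover have "?T \<subseteq> St_orth"
    using v by (auto intro: reflect_frame_in_St_orth)
  ultimately show ?thesis
    using assms unfolding connected_component_def by (intro exI[of _ ?T]) auto
next
  case False
  then have "CARD('k) < 2" by simp
  then have "CARD('k) = 1"
    using zero_less_card_finite[where 'a = 'k] by linarith
  then obtain r where "c = r *\<^sub>R a"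
  proof -
    obtain k :: 'k where k: "UNIV = {k}"
      using \<open>CARD('k) = 1\<close> card_1_singletonE by blast
    then have all: "j = k" for j :: 'k by auto
    obtain j where "a $ j \<noteq> 0"
      using \<open>a \<noteq> 0\<close> by (auto simp: vec_eq_iff)
    then have "a $ k \<noteq> 0"
      by (simp add: all[of j])
    then have "c $ j = ((c $ k / a $ k) *\<^sub>R a) $ j" for j
      by (simp add: all[of j])
    then have "c = (c $ k / a $ k) *\<^sub>R a"
      unfolding vec_eq_iff by blast
    then show thesis by (rule that)
  qed
  then have "reflect_frame c v = reflect_frame a v"
    using \<open>c \<noteq> 0\<close> by (auto simp: reflect_frame_def reflect_scaleR)
  then show ?thesis
    using v by (simp add: connected_component_refl reflect_frame_in_St_orth)
qed

lemma connected_component_reflect_frame_cong: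
  fixes v w :: "real^'k^'n"
  assumes "connected_component St_orth v w"
  shows "connected_component St_orth (reflect_frame c v) (reflect_frame c w)"
proof -
  obtain T where T: "connected T" "T \<subseteq> St_orth" "v \<in> T" "w \<in> T"
    using assms by (auto simp: connected_component_def)
  then have "connected (reflect_frame c ` T)"
    by (intro connected_continuous_image continuous_on_reflect_frame)
  moreover have "reflect_frame c ` T \<subseteq> St_orth"
    using T by (auto intro: reflect_frame_in_St_orth)
  ultimately show ?thesis
    using T unfolding connected_component_def by (intro exI[of _ "reflect_frame c ` T"]) auto
qed

lemma connected_St_orth:
  assumes "CARD('n::finite) < CARD('k::finite)"
  shows "connected (St_orth :: (real^'k^'n) set)"
proof -
  have "connected_component St_orth v w"
    if v: "v \<in> St_orth" and w: "w \<in> St_orth" for v w :: "real^'k^'n"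
  proof (rule St_orth_reflect_induct[where P = "connected_component St_orth v", OF v _ w])
    show "connected_component St_orth v v"
      using v by (simp add: connected_component_refl)
  next
    fix c :: "real^'k" and x :: "real^'k^'n"
    assume c: "c \<noteq> 0" and x: "x \<in> St_orth" and vx: "connected_component St_orth v x"
    \<comment> \<open>Fewer than \<open>CARD('k)\<close> vectors span a proper subspace, which
      leaves a nonzero normal \<open>a\<close> orthogonal to the whole frame.\<close>
    have "dim (range (($) x)) \<le> card (range (($) x))"
      by (intro dim_le_card') simp
    also have "\<dots> \<le> CARD('n)"
      by (rule card_image_le) simp
    also have "\<dots> < DIM(real^'k)"
      using assms by simp
    finally obtain a where "a \<noteq> 0" and a: "\<And>y. y \<in> span (range (($) x)) \<Longrightarrow> orthogonal a y"
      using orthogonal_to_subspace_exists by blast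
    have "a \<bullet> x $ i = 0" for i
      using a[of "x $ i"] by (simp add: orthogonal_def span_base)
    then have "reflect_frame a x = x"
      by (simp add: reflect_frame_def reflect_orthogonal)
    \<comment> \<open>The frame \<open>x\<close> is its own reflection along \<open>a\<close>, and
      \<open>a\<close> may be exchanged for \<open>c\<close> within one component.\<close>
    then have "connected_component St_orth x (reflect_frame c x)"
      using connected_component_reflect_frame_normal[OF x \<open>a \<noteq> 0\<close> c] by simp
    then show "connected_component St_orth v (reflect_frame c x)"
      using vx connected_component_trans by blast
  qed
  then show ?thesis
    by (simp add: connected_iff_connected_component)
qed

lemma St_orth_two_components:
  fixes v w :: "real^'k^'n"
  assumes v: "v \<in> St_orth" and w: "w \<in> St_orth" and "a \<noteq> 0"
  shows "connected_component St_orth v w \<or> connected_component St_orth (reflect_frame a v) w"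
proof (rule St_orth_reflect_induct[where P = "\<lambda>w. connected_component St_orth v w
      \<or> connected_component St_orth (reflect_frame a v) w", OF v _ w])
  show "connected_component St_orth v v \<or> connected_component St_orth (reflect_frame a v) v"
    using v by (simp add: connected_component_refl)
next
  fix c :: "real^'k" and x :: "real^'k^'n"
  assume c: "c \<noteq> 0" and x: "x \<in> St_orth"
    and vx: "connected_component St_orth v x \<or> connected_component St_orth (reflect_frame a v) x"
  have ac: "connected_component St_orth (reflect_frame a x) (reflect_frame c x)"
    using x \<open>a \<noteq> 0\<close> c by (rule connected_component_reflect_frame_normal)
  \<comment> \<open>Reflecting along \<open>a\<close> swaps the two alternatives, as it is an
    involution.\<close>
  from vx have "connected_component St_orth v (reflect_frame a x)
      \<or> connected_component St_orth (reflect_frame a v) (reflect_frame a x)"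
    using connected_component_reflect_frame_cong[of v x a]
      connected_component_reflect_frame_cong[of "reflect_frame a v" x a] by auto
  then show "connected_component St_orth v (reflect_frame c x)
      \<or> connected_component St_orth (reflect_frame a v) (reflect_frame c x)"
    using ac by (blast intro: connected_component_trans)
qed

section \<open>The square case: determinant and components\<close>

lemma det_frame_matrix: "det (frame_matrix v) = det v"
proof -
  have "frame_matrix v = transpose v"
    by (simp add: frame_matrix_def transpose_def)
  then show ?thesis by simp
qed

lemma St_orth_iff_orthogonal_matrix:
  "v \<in> St_orth \<longleftrightarrow> orthogonal_matrix (v :: real^'n^'n)"
  unfolding orthogonal_matrix_orthonormal_rows
  by (auto simp: St_orth_def row_def pairwise_def orthogonal_def norm_eq_1 vec_nth_inverse)

lemma det_St_orth: "v \<in> St_orth \<Longrightarrow> det v = 1 \<or> det (v :: real^'n^'n) = -1"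
  by (simp add: St_orth_iff_orthogonal_matrix det_orthogonal_matrix)

text \<open>A continuous function with finitely many values is constant on a connected set.\<close>

lemma connected_component_St_orth_det:
  fixes v w :: "real^'n^'n"
  assumes "connected_component St_orth v w"
  shows "det v = det w"
proof -
  obtain T where T: "connected T" "T \<subseteq> St_orth" "v \<in> T" "w \<in> T"
    using assms by (auto simp: connected_component_def)
  have "continuous_on T det"
    unfolding det_def by (intro continuous_intros)
  moreover have "finite (det ` T)"
    using T(2) det_St_orth by (intro finite_subset[of "det ` T" "{1, -1}"]) auto
  ultimately have "det constant_on T"
    using T(1) continuous_finite_range_constant by blast
  then show ?thesis
    using T by (auto simp: constant_on_def)
qed

lemma St_orth_det_witnesses:
  obtains v w :: "real^'n^'n"
  where "v \<in> St_orth" "w \<in> St_orth" "det v = 1" "det w = -1"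
proof -
  obtain k :: 'n where True by blast
  \<comment> \<open>The identity with row \<open>k\<close> negated. The sign is written as a scalar
    factor of that row so that \<open>det_row_mul\<close> can extract it.\<close>
  define w :: "real^'n^'n" where "w = (\<chi> i. if i = k then (-1) *s axis k 1 else axis i 1)"
  have "det w = - det ((\<chi> i. if i = k then axis k 1 else axis i 1) :: real^'n^'n)"
    unfolding w_def by (subst det_row_mul) simp
  also have "((\<chi> i. if i = k then axis k 1 else axis i 1) :: real^'n^'n) = mat 1"
    by (auto simp: vec_eq_iff mat_def axis_def)
  finally have "det w = -1" by simp
  moreover have "w \<in> St_orth"
    by (auto simp: St_orth_def w_def inner_axis_axis)
  moreover have "mat 1 \<in> (St_orth :: (real^'n^'n) set)"
    by (simp add: St_orth_iff_orthogonal_matrix orthogonal_matrix_id)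
  ultimately show thesis
    using that[of "mat 1" w] by simp
qed

lemma connected_component_St_orth_iff:
  fixes v w :: "real^'n^'n"
  assumes v: "v \<in> St_orth" and w: "w \<in> St_orth"
  shows "connected_component St_orth v w \<longleftrightarrow> det v = det w"
proof
  assume eq: "det v = det w"
  obtain x y :: "real^'n^'n" where xy: "x \<in> St_orth" "y \<in> St_orth" "det x = 1" "det y = -1"
    using St_orth_det_witnesses .
  obtain u :: "real^'n^'n" where u: "u \<in> St_orth" "det u \<noteq> det v"
    using xy by (cases "det v = 1") auto
  obtain a :: "real^'n" where a: "a \<noteq> 0"
    using axis_eq_0_iff[of _ "1::real"] one_neq_zero by blast
  \<comment> \<open>The frame \<open>u\<close> has the other determinant, so it cannot share a
    component with \<open>v\<close> and must lie in that of the reflected frame. In the second case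
    \<open>w\<close> lies there too, which would force \<open>det w = det u\<close>.\<close>
  consider "connected_component St_orth v w"
    | "connected_component St_orth (reflect_frame a v) w"
      "connected_component St_orth (reflect_frame a v) u"
    using St_orth_two_components[OF v w a] St_orth_two_components[OF v u(1) a]
      connected_component_St_orth_det[of v u] u(2) by auto
  then show "connected_component St_orth v w"
  proof cases
    case 2
    then have "det w = det u"
      using connected_component_St_orth_det[of "reflect_frame a v" w]
        connected_component_St_orth_det[of "reflect_frame a v" u] by simp
    then show ?thesis
      using eq u(2) by simp
  qed
qed (rule connected_component_St_orth_det)

lemma components_St_orth:
  "components (St_orth :: (real^'n^'n) set) =
    {{v \<in> St_orth. det v > 0}, {v \<in> St_orth. det v < 0}}"
proof -
  have comp: "connected_component_set St_orth v = {w \<in> St_orth. det w = det v}"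
    if "v \<in> St_orth" for v :: "real^'n^'n"
  proof (intro set_eqI iffI)
    fix w assume "w \<in> connected_component_set St_orth v"
    then show "w \<in> {w \<in> St_orth. det w = det v}"
      using connected_component_St_orth_det[of v w] connected_component_in[of St_orth v w] by simp
  qed (use connected_component_St_orth_iff[OF that] in auto)
  obtain x y :: "real^'n^'n" where xy: "x \<in> St_orth" "y \<in> St_orth" "det x = 1" "det y = -1"
    using St_orth_det_witnesses .
  have sgn: "det v > 0 \<longleftrightarrow> det v = 1" "det v < 0 \<longleftrightarrow> det v = -1"
    if "v \<in> St_orth" for v :: "real^'n^'n"
    using det_St_orth[OF that] by auto
  have pos: "{v \<in> St_orth. det v > 0} = {v \<in> St_orth. det (v :: real^'n^'n) = 1}"
    and neg: "{v \<in> St_orth. det v < 0} = {v \<in> St_orth. det (v :: real^'n^'n) = -1}"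
    using sgn by (auto cong: conj_cong)
  \<comment> \<open>The components are the nonempty fibres of \<open>det\<close>, one for each value
    it attains.\<close>
  have "components (St_orth :: (real^'n^'n) set) =
      (\<lambda>v. {w \<in> St_orth. det w = det v}) ` (St_orth :: (real^'n^'n) set)"
    unfolding components_def by (rule image_cong[OF refl comp])
  also have "\<dots> = (\<lambda>d. {w \<in> St_orth. det w = d}) ` det ` (St_orth :: (real^'n^'n) set)"
    by (simp add: image_image)
  also have "det ` (St_orth :: (real^'n^'n) set) = {1, -1}"
  proof (intro equalityI subsetI)
    fix d assume "d \<in> {1, -1 :: real}"
    then show "d \<in> det ` (St_orth :: (real^'n^'n) set)"
      using xy by (metis image_eqI insertE singletonD)
  qed (use det_St_orth in blast)
  finally show ?thesis
    by (simp add: pos neg)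
qed

text \<open>What remains is that the two sets listed in \<open>components_St_orth\<close> differ,
  which a frame of determinant 1 shows.\<close>

lemma card_components_St_orth: "card (components (St_orth :: (real^'n^'n) set)) = 2"
proof -
  obtain x y :: "real^'n^'n" where xy: "x \<in> St_orth" "y \<in> St_orth" "det x = 1" "det y = -1"
    using St_orth_det_witnesses .
  then have "x \<in> {v \<in> St_orth. det v > 0}" "x \<notin> {v \<in> St_orth. det v < 0}"
    by auto
  then have "{v \<in> St_orth. det v > 0} \<noteq> {v \<in> St_orth. det (v :: real^'n^'n) < 0}"
    by blast
  then show ?thesis
    by (simp add: components_St_orth)
qed

text \<open>The index types may differ although their sizes agree, and \<open>det\<close> requires a
  square type. Relabelling coordinates along a bijection preserves inner products and maps the
  frames continuously onto the square ones.\<close>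

lemma not_connected_St_orth:
  assumes "CARD('n::finite) = CARD('k::finite)"
  shows "\<not> connected (St_orth :: (real^'k^'n) set)"
proof
  assume conn: "connected (St_orth :: (real^'k^'n) set)"
  obtain f :: "'n \<Rightarrow> 'k" where f: "bij f"
    using finite_same_card_bij[of "UNIV :: 'n set" "UNIV :: 'k set"] assms by auto
  define g :: "real^'k^'n \<Rightarrow> real^'n^'n" where "g v = (\<chi> i j. v $ i $ f j)" for v
  have inner_g: "g v $ i \<bullet> g v $ j = v $ i \<bullet> v $ j" for v i j
    using sum.reindex_bij_betw[OF f, of "\<lambda>l. v $ i $ l * v $ j $ l"]
    by (simp add: g_def inner_vec_def)
  have "g ` St_orth = St_orth"
  proof (intro equalityI subsetI)
    fix w :: "real^'n^'n" assume w: "w \<in> St_orth"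
    define v :: "real^'k^'n" where "v = (\<chi> i j. w $ i $ inv f j)"
    have "w = g v"
      using f by (simp add: v_def g_def vec_eq_iff bij_is_inj)
    then show "w \<in> g ` St_orth"
      using w by (auto simp: St_orth_def inner_g)
  qed (auto simp: St_orth_def inner_g)
  moreover have "continuous_on St_orth g"
    unfolding g_def by (intro continuous_intros)
  ultimately have "connected (St_orth :: (real^'n^'n) set)"
    using conn connected_continuous_image[of St_orth g] by simp
  \<comment> \<open>A connected set has at most one component, against the count of two.\<close>
  then have "card (components (St_orth :: (real^'n^'n) set)) \<le> card {St_orth :: (real^'n^'n) set}"
    by (intro card_mono) (simp_all add: connected_eq_components_subset_sing)
  then show False
    by (simp add: card_components_St_orth)
qed

text \<open>The case \<open>k = n\<close> is expressed by taking \<open>'n\<close> for both index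
  types, so that the frame matrix is square.\<close>

theorem theorem4p1:
  assumes "1 \<le> CARD('n::finite)" and "CARD('n) \<le> CARD('k::finite)"
  shows "(connected (St_orth :: (real^'k^'n) set) \<longleftrightarrow> CARD('k) \<ge> CARD('n) + 1) \<and>
    card (components (St_orth :: (real^'n^'n) set)) = 2 \<and>
    components (St_orth :: (real^'n^'n) set) =
      {{v \<in> St_orth. det (frame_matrix v) > 0}, {v \<in> St_orth. det (frame_matrix v) < 0}}"
proof (intro conjI)
  show "connected (St_orth :: (real^'k^'n) set) \<longleftrightarrow> CARD('k) \<ge> CARD('n) + 1"
    using connected_St_orth[where 'n = 'n and 'k = 'k]
      not_connected_St_orth[where 'n = 'n and 'k = 'k] assms(2) by linarith
qed (simp_all only: card_components_St_orth, simp only: components_St_orth det_frame_matrix)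

end
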